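(* Let $X$ be a Banach space and let $f:[0,1]\to X$ be a bounded function that is Riemann integrable. Then $f$ is RL-integrable (with respect to Lebesgue measure on $[0,1]$) and its RL-integral equals its Riemann integral.
   Context: Riemann integrability: a bounded function $f:[0,1]\to X$ is Riemann integrable with integral $x\in X$ if for every $\epsilon>0$ there is $\delta>0$ such that for every partition of $[0,1]$ into finitely many intervals $\{\Delta_i\}_{i=1}^N$ with $\max_i|\Delta_i|<\delta$ and every choice of points $t_i\in\Delta_i$, $\left\|\sum_{i=1}^N f(t_i)|\Delta_i|-x\right\|<\epsilon$. RL-integrability: let $(\Omega,\Sigma,\mu)$ be a finite measure space (here $[0,1]$ with Lebesgue measure). A partition of a measurable set $A\subset\Omega$ is a countable family $\Pi=\{\Delta_i\}$ of pairwise disjoint measurable sets with union $A$ (finite families are allowed). A set of sampling points for $\Pi$ is $T=\{t_i\}$ with $t_i\in\Delta_i$. Put $S(f,\Pi,T)=\sum_i f(t_i)\mu(\Delta_i)$. Write $\Gamma\succ\Pi$ ($\Gamma$ is finer than $\Pi$) if every member of $\Pi$ is a union of members of $\Gamma$. A function $f:\Omega\to X$ is RL-integrable over $A$, with RL-integral $x\in X$ (written $\int_A f\,d\mu=x$), if for every $\epsilon>0$ there is a partition $\Pi$ of $A$ such that for every $\Gamma\succ\Pi$ and every set $T$ of sampling points for $\Gamma$, the series $S(f,\Gamma,T)$ converges absolutely and $\|S(f,\Gamma,T)-x\|<\epsilon$. RL-integrable without further qualification means RL-integrable over $\Omega$. *)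

theory Defs
  imports "HOL-Analysis.Analysis"
begin

subsection \<open>The Riemann integral on the unit interval\<close>

definition interval_partition :: "real set set \<Rightarrow> bool" where
  "interval_partition P \<longleftrightarrow>
     partition_on {0..1} P \<and> finite P \<and> (\<forall>D\<in>P. is_interval D)"

text \<open>Members of a partition are nonempty by \<^const>\<open>partition_on\<close>; this loses nothing, since
  every member has to contain a sampling point. Sampling points are a choice function on the
  partition.\<close>

definition sampling :: "'w set set \<Rightarrow> ('w set \<Rightarrow> 'w) \<Rightarrow> bool" where
  "sampling P t \<longleftrightarrow> (\<forall>D\<in>P. t D \<in> D)"

definition has_riemann_integral :: "(real \<Rightarrow> 'a::real_normed_vector) \<Rightarrow> 'a \<Rightarrow> bool" where
  "has_riemann_integral f x \<longleftrightarrow>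
     (\<forall>\<epsilon>>0. \<exists>\<delta>>0. \<forall>P t. interval_partition P \<and> (\<forall>D\<in>P. measure lborel D < \<delta>) \<and> sampling P t \<longrightarrow>
        norm ((\<Sum>D\<in>P. measure lborel D *\<^sub>R f (t D)) - x) < \<epsilon>)"

definition riemann_integrable :: "(real \<Rightarrow> 'a::real_normed_vector) \<Rightarrow> bool" where
  "riemann_integrable f \<longleftrightarrow> (\<exists>x. has_riemann_integral f x)"

definition riemann_integral :: "(real \<Rightarrow> 'a::real_normed_vector) \<Rightarrow> 'a" where
  "riemann_integral f = (THE x. has_riemann_integral f x)"

subsection \<open>The RL-integral\<close>

definition measurable_partition :: "'w measure \<Rightarrow> 'w set \<Rightarrow> 'w set set \<Rightarrow> bool" where
  "measurable_partition M A P \<longleftrightarrow> partition_on A P \<and> countable P \<and> P \<subseteq> sets M"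

definition finer :: "'w set set \<Rightarrow> 'w set set \<Rightarrow> bool" where
  "finer G P \<longleftrightarrow> (\<forall>D\<in>P. \<exists>H\<subseteq>G. D = \<Union>H)"

definition has_RL_integral ::
  "'w measure \<Rightarrow> 'w set \<Rightarrow> ('w \<Rightarrow> 'a::real_normed_vector) \<Rightarrow> 'a \<Rightarrow> bool" where
  "has_RL_integral M A f x \<longleftrightarrow>
     (\<forall>\<epsilon>>0. \<exists>P. measurable_partition M A P \<and>
        (\<forall>G t. measurable_partition M A G \<and> finer G P \<and> sampling G t \<longrightarrow>
           (\<lambda>D. norm (measure M D *\<^sub>R f (t D))) summable_on G \<and>
           norm ((\<Sum>\<^sub>\<infinity>D\<in>G. measure M D *\<^sub>R f (t D)) - x) < \<epsilon>))"

definition RL_integrable :: "'w measure \<Rightarrow> 'w set \<Rightarrow> ('w \<Rightarrow> 'a::real_normed_vector) \<Rightarrow> bool" where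
  "RL_integrable M A f \<longleftrightarrow> (\<exists>x. has_RL_integral M A f x)"

definition RL_integral :: "'w measure \<Rightarrow> 'w set \<Rightarrow> ('w \<Rightarrow> 'a::real_normed_vector) \<Rightarrow> 'a" where
  "RL_integral M A f = (THE x. has_RL_integral M A f x)"

subsection \<open>Both integrals are unique\<close>

lemma exists_sampling:
  assumes "partition_on A P"
  shows "\<exists>t. sampling P t"
proof
  show "sampling P (\<lambda>D. SOME w. w \<in> D)"
    using assms unfolding sampling_def partition_on_def by (metis some_in_eq)
qed

lemma eq_of_common_approx:
  fixes x y :: "'a::real_normed_vector"
  assumes "\<And>e. e > 0 \<Longrightarrow> \<exists>s. norm (s - x) < e \<and> norm (s - y) < e"
  shows "x = y"
proof (rule ccontr)
  assume "x \<noteq> y"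
  then have "norm (x - y) / 2 > 0" by simp
  from assms[OF this] obtain s where
    "norm (s - x) < norm (x - y) / 2" "norm (s - y) < norm (x - y) / 2" by blast
  moreover have "norm (x - y) \<le> norm (s - x) + norm (s - y)"
    using dist_triangle[of x y s] by (simp add: dist_norm norm_minus_commute)
  ultimately show False by linarith
qed

lemma exists_fine_interval_partition:
  assumes "\<delta> > 0"
  shows "\<exists>P. interval_partition P \<and> (\<forall>D\<in>P. measure lborel D < \<delta>)"
proof -
  obtain n :: nat where n: "inverse (real (Suc n)) < \<delta>"
    using reals_Archimedean[OF assms] by blast
  define N where "N = real (Suc n)"
  have N: "N > 0" "1 / N < \<delta>" using n by (simp_all add: N_def divide_inverse)
  define E where "E = (\<lambda>k::int. {x \<in> {0..1}. \<lfloor>N * x\<rfloor> = k})"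
  define P where "P = E ` ((\<lambda>x. \<lfloor>N * x\<rfloor>) ` {0..1})"
  have "(\<lambda>x. \<lfloor>N * x\<rfloor>) ` {0..1} \<subseteq> {0..int (Suc n)}"
  proof
    fix k assume "k \<in> (\<lambda>x. \<lfloor>N * x\<rfloor>) ` {0..1}"
    then obtain x where x: "x \<in> {0..1}" "k = \<lfloor>N * x\<rfloor>" by blast
    have "N * x \<le> N" "N * x \<ge> 0" using x N by (auto simp: mult_left_le)
    then have "\<lfloor>N * x\<rfloor> \<le> \<lfloor>N\<rfloor>" "\<lfloor>N * x\<rfloor> \<ge> 0" using floor_mono by auto
    moreover have "\<lfloor>N\<rfloor> = int (Suc n)" unfolding N_def by (rule floor_of_nat)
    ultimately show "k \<in> {0..int (Suc n)}" using x by simp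
  qed
  then have "finite P" unfolding P_def using finite_subset by blast
  moreover have "partition_on {0..1} P"
    by (rule partition_onI) (auto simp: P_def E_def disjnt_def)
  moreover have "is_interval (E k)" for k
    unfolding is_interval_1
  proof (intro ballI allI impI)
    fix a b x assume ab: "a \<in> E k" "b \<in> E k" and x: "a \<le> x \<and> x \<le> b"
    then have "N * a \<le> N * x" "N * x \<le> N * b" using N by auto
    then have "\<lfloor>N * a\<rfloor> \<le> \<lfloor>N * x\<rfloor>" "\<lfloor>N * x\<rfloor> \<le> \<lfloor>N * b\<rfloor>" by (auto intro: floor_mono)
    then show "x \<in> E k" using ab x by (auto simp: E_def)
  qed
  moreover have "measure lborel (E k) < \<delta>" for k
  proof -
    have "E k \<subseteq> {of_int k / N..(of_int k + 1) / N}"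
    proof
      fix x assume "x \<in> E k"
      then have "of_int k \<le> N * x" "N * x \<le> of_int k + 1"
        using floor_correct[of "N * x"] by (auto simp: E_def)
      then show "x \<in> {of_int k / N..(of_int k + 1) / N}"
        using N by (auto simp: field_simps)
    qed
    moreover have "E k \<in> sets borel" unfolding E_def by measurable
    ultimately have "measure lborel (E k) \<le> measure lborel {of_int k / N..(of_int k + 1) / N}"
      by (intro measure_mono_fmeasurable) (auto simp: fmeasurable_def emeasure_lborel_Icc_eq)
    also have "\<dots> = 1 / N" using N by (simp add: field_simps)
    finally show ?thesis using N by linarith
  qed
  ultimately show ?thesis unfolding interval_partition_def P_def by blast
qed

lemma has_riemann_integral_unique:
  assumes "has_riemann_integral f x" "has_riemann_integral f y"
  shows "x = y"
proof (rule eq_of_common_approx)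
  fix e :: real assume "e > 0"
  obtain d1 where d1: "d1 > 0" "\<And>P t. interval_partition P \<Longrightarrow> (\<forall>D\<in>P. measure lborel D < d1) \<Longrightarrow>
      sampling P t \<Longrightarrow> norm ((\<Sum>D\<in>P. measure lborel D *\<^sub>R f (t D)) - x) < e"
    using assms(1) \<open>e > 0\<close> unfolding has_riemann_integral_def by meson
  obtain d2 where d2: "d2 > 0" "\<And>P t. interval_partition P \<Longrightarrow> (\<forall>D\<in>P. measure lborel D < d2) \<Longrightarrow>
      sampling P t \<Longrightarrow> norm ((\<Sum>D\<in>P. measure lborel D *\<^sub>R f (t D)) - y) < e"
    using assms(2) \<open>e > 0\<close> unfolding has_riemann_integral_def by meson
  obtain P where P: "interval_partition P" "\<forall>D\<in>P. measure lborel D < min d1 d2"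
    using exists_fine_interval_partition[of "min d1 d2"] d1(1) d2(1) by auto
  obtain t where "sampling P t"
    using P(1) exists_sampling unfolding interval_partition_def by blast
  with P d1(2)[of P t] d2(2)[of P t]
  show "\<exists>s. norm (s - x) < e \<and> norm (s - y) < e" by auto
qed

lemma exists_common_refinement:
  assumes "measurable_partition M A P" "measurable_partition M A Q"
  shows "\<exists>G. measurable_partition M A G \<and> finer G P \<and> finer G Q"
proof -
  define G where "G = (\<lambda>(D, E). D \<inter> E) ` (P \<times> Q) - {{}}"
  have P: "\<Union>P = A" "disjoint P" "countable P" "P \<subseteq> sets M"
    and Q: "\<Union>Q = A" "disjoint Q" "countable Q" "Q \<subseteq> sets M"
    using assms unfolding measurable_partition_def partition_on_def by auto
  have "\<Union>G = (\<Union>D\<in>P. \<Union>E\<in>Q. D \<inter> E)" unfolding G_def by blast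
  also have "\<dots> = \<Union>P \<inter> \<Union>Q" by blast
  finally have "\<Union>G = A" using P(1) Q(1) by simp
  moreover have "disjnt p q" if "p \<in> G" "q \<in> G" "p \<noteq> q" for p q
  proof -
    obtain D E D' E' where *: "p = D \<inter> E" "q = D' \<inter> E'" "D \<in> P" "D' \<in> P" "E \<in> Q" "E' \<in> Q"
      using \<open>p \<in> G\<close> \<open>q \<in> G\<close> unfolding G_def by auto
    with \<open>p \<noteq> q\<close> have "D \<noteq> D' \<or> E \<noteq> E'" by blast
    then have "disjnt D D' \<or> disjnt E E'"
      using * pairwiseD[OF P(2)] pairwiseD[OF Q(2)] by blast
    then show ?thesis unfolding * disjnt_def by blast
  qed
  ultimately have "partition_on A G" by (intro partition_onI) (auto simp: G_def)
  moreover have "countable G" "G \<subseteq> sets M" using P Q unfolding G_def by auto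
  moreover have "finer G P" unfolding finer_def
  proof
    fix D assume "D \<in> P"
    then have "D \<subseteq> \<Union>Q" using P(1) Q(1) by blast
    then have "D = \<Union>((\<lambda>E. D \<inter> E) ` Q - {{}})" by blast
    moreover have "(\<lambda>E. D \<inter> E) ` Q - {{}} \<subseteq> G" using \<open>D \<in> P\<close> unfolding G_def by auto
    ultimately show "\<exists>H\<subseteq>G. D = \<Union>H" by blast
  qed
  moreover have "finer G Q" unfolding finer_def
  proof
    fix E assume "E \<in> Q"
    then have "E \<subseteq> \<Union>P" using P(1) Q(1) by blast
    then have "E = \<Union>((\<lambda>D. D \<inter> E) ` P - {{}})" by blast
    moreover have "(\<lambda>D. D \<inter> E) ` P - {{}} \<subseteq> G" using \<open>E \<in> Q\<close> unfolding G_def by auto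
    ultimately show "\<exists>H\<subseteq>G. E = \<Union>H" by blast
  qed
  ultimately show ?thesis unfolding measurable_partition_def by blast
qed

lemma has_RL_integral_unique:
  assumes "has_RL_integral M A f x" "has_RL_integral M A f y"
  shows "x = y"
proof (rule eq_of_common_approx)
  fix e :: real assume "e > 0"
  obtain P where P: "measurable_partition M A P"
    "\<And>G t. measurable_partition M A G \<Longrightarrow> finer G P \<Longrightarrow> sampling G t \<Longrightarrow>
        norm ((\<Sum>\<^sub>\<infinity>D\<in>G. measure M D *\<^sub>R f (t D)) - x) < e"
    using assms(1) \<open>e > 0\<close> unfolding has_RL_integral_def by meson
  obtain Q where Q: "measurable_partition M A Q"
    "\<And>G t. measurable_partition M A G \<Longrightarrow> finer G Q \<Longrightarrow> sampling G t \<Longrightarrow>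
        norm ((\<Sum>\<^sub>\<infinity>D\<in>G. measure M D *\<^sub>R f (t D)) - y) < e"
    using assms(2) \<open>e > 0\<close> unfolding has_RL_integral_def by meson
  obtain G where G: "measurable_partition M A G" "finer G P" "finer G Q"
    using exists_common_refinement[OF P(1) Q(1)] by blast
  obtain t where "sampling G t"
    using G(1) exists_sampling unfolding measurable_partition_def by blast
  with G P(2) Q(2) show "\<exists>s. norm (s - x) < e \<and> norm (s - y) < e" by blast
qed

lemma riemann_integral_eq: "has_riemann_integral f x \<Longrightarrow> riemann_integral f = x"
  unfolding riemann_integral_def by (blast intro: has_riemann_integral_unique)

lemma RL_integral_eq: "has_RL_integral M A f x \<Longrightarrow> RL_integral M A f = x"
  unfolding RL_integral_def by (blast intro: has_RL_integral_unique)

end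

theory Submission
  imports Defs
begin

text \<open>Take an interval partition \<open>P\<close> whose mesh is small enough for all its Riemann sums to lie
  within \<open>\<epsilon>/2\<close> of the integral. If \<open>\<Gamma>\<close> refines \<open>P\<close>, the part of a \<open>\<Gamma>\<close>-sum inside a member \<open>D\<close> of \<open>P\<close>
  is a countable weighted average of the values \<open>|D| f(s)\<close> with \<open>s \<in> D\<close>. So the \<open>\<Gamma>\<close>-sum is obtained
  from Riemann sums over \<open>P\<close> by averaging in one member after the other, which does not leave the
  closed ball of radius \<open>\<epsilon>/2\<close>.\<close>

text \<open>Countable additivity as an unordered sum indexed by the sets themselves, which is the
  shape of the RL-sums. It later provides the averaging weights.\<close>

lemma has_sum_measure_Union:
  assumes "countable G" "disjoint G" "G \<subseteq> fmeasurable M" "\<Union>G \<in> fmeasurable M"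
  shows "(measure M has_sum measure M (\<Union>G)) G"
proof (cases "finite G")
  case True
  then have "measure M (\<Union>G) = (\<Sum>D\<in>G. measure M D)"
    using assms by (intro measure_Union') auto
  with True show ?thesis by (simp add: has_sum_finite_iff)
next
  case False
  \<comment> \<open>\<open>from_nat_into\<close> is a bijection from all naturals only when
    \<open>G\<close> is infinite; hence the case split.\<close>
  define h where "h = from_nat_into G"
  have h: "bij_betw h UNIV G"
    unfolding h_def using bij_betw_from_nat_into[OF assms(1) False] .
  have "disjoint_family h"
    using h assms(2) unfolding disjoint_family_on_def bij_betw_def
    by (metis disjointD inj_eq rangeI)
  moreover have U: "(\<Union>i. h i) = \<Union>G" using h by (simp add: bij_betw_def)
  moreover have "range h \<subseteq> sets M" using h assms(3) by (auto simp: bij_betw_def)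
  ultimately have "(\<lambda>i. measure M (h i)) sums measure M (\<Union>G)"
    using measure_UNION[of h M] assms(4) by (simp add: fmeasurable_def less_top)
  \<comment> \<open>The terms are nonnegative, so the series converges absolutely and the order of
    summation is irrelevant.\<close>
  then have "((\<lambda>i. measure M (h i)) has_sum measure M (\<Union>G)) UNIV"
    by (intro norm_summable_imp_has_sum) (auto simp: sums_iff)
  then show ?thesis using has_sum_reindex_bij_betw[OF h] by blast
qed

text \<open>For \<open>W > 0\<close> the numbers \<open>w i / W\<close> sum to 1, and
  \<open>a\<close> plus the weighted sum is the average of the points
  \<open>a + W *\<^sub>R g i\<close> with these weights. A closed ball around 0 is stable under such
  countable averages.\<close>

lemma norm_add_weighted_infsum_le:
  fixes g :: "'i \<Rightarrow> 'a::real_normed_vector"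
  assumes w: "(w has_sum W) G" "\<And>i. i \<in> G \<Longrightarrow> w i \<ge> 0"
    and g: "(\<lambda>i. w i *\<^sub>R g i) summable_on G"
    and "G \<noteq> {}"
    and le: "\<And>i. i \<in> G \<Longrightarrow> norm (a + W *\<^sub>R g i) \<le> e"
  shows "norm (a + (\<Sum>\<^sub>\<infinity>i\<in>G. w i *\<^sub>R g i)) \<le> e"
proof (cases "W = 0")
  case True
  \<comment> \<open>Nonnegative weights with total 0 all vanish, so only \<open>norm a\<close> has
    to be bounded; any single index in the nonempty \<open>G\<close> gives that bound.\<close>
  have "w i = 0" if "i \<in> G" for i
  proof -
    have "infsum w G = 0" "w summable_on G" using w(1) True by (auto simp: infsumI summable_on_def)
    then show ?thesis using nonneg_infsum_le_0D[of w G i] w(2) that by simp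
  qed
  then have "(\<Sum>\<^sub>\<infinity>i\<in>G. w i *\<^sub>R g i) = 0" by (intro infsum_0) simp
  then show ?thesis using True \<open>G \<noteq> {}\<close> le by auto
next
  case False
  let ?v = "\<lambda>i. w i / W"
  have "W \<ge> 0" using has_sum_nonneg[OF w(1)] w(2) by blast
  then have W: "W > 0" using False by simp
  have v: "(?v has_sum 1) G" using has_sum_cmult_left[OF w(1), of "inverse W"] W
    by (simp add: divide_inverse)
  have "((\<lambda>i. ?v i *\<^sub>R a + w i *\<^sub>R g i) has_sum 1 *\<^sub>R a + (\<Sum>\<^sub>\<infinity>i\<in>G. w i *\<^sub>R g i)) G"
    by (intro has_sum_add has_sum_infsum[OF g]
        has_sum_bounded_linear[OF bounded_linear_scaleR_left v])
  then have *: "((\<lambda>i. ?v i *\<^sub>R (a + W *\<^sub>R g i)) has_sum (a + (\<Sum>\<^sub>\<infinity>i\<in>G. w i *\<^sub>R g i))) G"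
    using W by (simp add: scaleR_add_right)
  \<comment> \<open>The averaged bounds form the majorant that controls the norm of the averaged
    vectors.\<close>
  have "((\<lambda>i. ?v i * e) has_sum e) G"
    using has_sum_cmult_left[OF v, of e] by simp
  with * show ?thesis
  proof (rule norm_infsum_le)
    fix i assume "i \<in> G"
    then have "\<bar>?v i\<bar> = ?v i" "?v i \<ge> 0" "norm (a + W *\<^sub>R g i) \<le> e"
      using le w(2) W by auto
    then show "norm (?v i *\<^sub>R (a + W *\<^sub>R g i)) \<le> ?v i * e"
      by (metis norm_scaleR mult_left_mono)
  qed
qed

text \<open>The last assumption says that in any one coordinate \<open>D\<close> a bound valid for
  all values \<open>v D p\<close> survives replacing them by \<open>I D\<close>. Induction performs
  the replacement one coordinate at a time.\<close>

lemma norm_sum_replace_le: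
  fixes v :: "'i \<Rightarrow> 'p \<Rightarrow> 'a::real_normed_vector"
  assumes "finite P"
    and "\<And>s. (\<And>D. D \<in> P \<Longrightarrow> s D \<in> B D) \<Longrightarrow> norm ((\<Sum>D\<in>P. v D (s D)) - x) \<le> e"
    and "\<And>D a. D \<in> P \<Longrightarrow> (\<And>p. p \<in> B D \<Longrightarrow> norm (a + v D p) \<le> e) \<Longrightarrow> norm (a + I D) \<le> e"
  shows "norm ((\<Sum>D\<in>P. I D) - x) \<le> e"
  using assms
proof (induction P arbitrary: x rule: finite_induct)
  case empty
  then show ?case by simp
next
  case (insert D P)
  have "norm (((\<Sum>D\<in>P. I D) - x) + v D p) \<le> e" if p: "p \<in> B D" for p
  proof -
    \<comment> \<open>For fixed \<open>p\<close> the new term \<open>v D p\<close> is absorbed into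
      the centre, which is why \<open>x\<close> is arbitrary in the induction. Choices
      \<open>s\<close> on \<open>P\<close> extend to \<open>insert D P\<close> by the value
      \<open>p\<close>.\<close>
    have "norm ((\<Sum>D\<in>P. I D) - (x - v D p)) \<le> e"
    proof (rule insert.IH)
      fix s assume s: "\<And>E. E \<in> P \<Longrightarrow> s E \<in> B E"
      have "(\<Sum>E\<in>P. v E ((s(D := p)) E)) = (\<Sum>E\<in>P. v E (s E))"
        using insert.hyps by (intro sum.cong) auto
      moreover have "norm ((\<Sum>E\<in>insert D P. v E ((s(D := p)) E)) - x) \<le> e"
        using s p by (intro insert.prems(1)) auto
      ultimately show "norm ((\<Sum>E\<in>P. v E (s E)) - (x - v D p)) \<le> e"
        using insert.hyps by (simp add: algebra_simps)
    qed (use insert.prems in auto)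
    then show ?thesis by (simp add: algebra_simps)
  qed
  then have "norm (((\<Sum>D\<in>P. I D) - x) + I D) \<le> e"
    using insert.prems(2) by blast
  then show ?case using insert.hyps by (simp add: algebra_simps)
qed

lemma finer_Union_subsets:
  assumes "finer G P" "D \<in> P"
  shows "\<Union>{E \<in> G. E \<subseteq> D} = D"
proof -
  obtain H where "H \<subseteq> G" "D = \<Union>H" using assms unfolding finer_def by blast
  then have "H \<subseteq> {E \<in> G. E \<subseteq> D}" by blast
  then have "D \<subseteq> \<Union>{E \<in> G. E \<subseteq> D}" using \<open>D = \<Union>H\<close> by (metis Union_mono)
  then show ?thesis by blast
qed

text \<open>A point of \<open>E\<close> lies in some \<open>D\<close> of \<open>P\<close>, and
  \<open>D\<close> is covered by the members of \<open>G\<close> inside it. By disjointness the one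
  containing that point is \<open>E\<close>.\<close>

lemma finer_subset_member:
  assumes G: "partition_on A G" and P: "partition_on A P" and fin: "finer G P" and E: "E \<in> G"
  shows "\<exists>D\<in>P. E \<subseteq> D"
proof -
  have "E \<noteq> {}" "\<Union>G = A" "disjoint G" "\<Union>P = A"
    using G P E unfolding partition_on_def by auto
  then obtain p D where D: "p \<in> E" "D \<in> P" "p \<in> D" using E by (metis UnionE UnionI all_not_in_conv)
  have "p \<in> \<Union>{F \<in> G. F \<subseteq> D}" using finer_Union_subsets[OF fin D(2)] D(3) by simp
  then obtain F where F: "F \<in> G" "F \<subseteq> D" "p \<in> F" by auto
  have "F = E" using disjointD[OF \<open>disjoint G\<close> F(1) E] F(3) D(1) by blast
  with F(2) D(2) show ?thesis by auto
qed

lemma infsum_eq_sum_over_coarser: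
  fixes u :: "'w set \<Rightarrow> 'a::banach"
  assumes G: "partition_on A G" and P: "partition_on A P" and "finer G P" "finite P"
    and u: "u summable_on G"
  shows "(\<Sum>\<^sub>\<infinity>E\<in>G. u E) = (\<Sum>D\<in>P. \<Sum>\<^sub>\<infinity>E\<in>{E\<in>G. E \<subseteq> D}. u E)"
proof -
  have "(\<Union>D\<in>P. {E\<in>G. E \<subseteq> D}) = G"
    using finer_subset_member[OF G P \<open>finer G P\<close>] by blast
  moreover have "{E\<in>G. E \<subseteq> D} \<inter> {E\<in>G. E \<subseteq> D'} = {}" if "D \<in> P" "D' \<in> P" "D \<noteq> D'" for D D'
  proof -
    have "D \<inter> D' = {}" using P that unfolding partition_on_def by (metis disjointD)
    \<comment> \<open>The blocks of \<open>G\<close> below different members of \<open>P\<close>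
      could share only the empty set, which a partition excludes.\<close>
    then have "E = {}" if "E \<subseteq> D" "E \<subseteq> D'" for E using that by blast
    moreover have "{} \<notin> G" using G unfolding partition_on_def by blast
    ultimately show ?thesis by blast
  qed
  moreover have "u summable_on {E\<in>G. E \<subseteq> D}" for D
    using u by (rule summable_on_subset_banach) auto
  ultimately show ?thesis
    using sum_infsum[OF \<open>finite P\<close>, where f = u and B = "\<lambda>D. {E\<in>G. E \<subseteq> D}"] by simp
qed

text \<open>The core estimate, for an arbitrary finite measure. All that remains of Riemann
  integrability is the bound \<open>le\<close> on the sums over one finite partition.\<close>

lemma RL_sum_of_refinement:
  fixes f :: "'w \<Rightarrow> 'a::banach"
  assumes "finite_measure M" and bdd: "bounded (f ` A)" and A: "A \<in> sets M"
    and P: "measurable_partition M A P" "finite P"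
    and G: "measurable_partition M A G" "finer G P" "sampling G t"
    and le: "\<And>s. sampling P s \<Longrightarrow> norm ((\<Sum>D\<in>P. measure M D *\<^sub>R f (s D)) - x) \<le> e"
  shows "(\<lambda>E. norm (measure M E *\<^sub>R f (t E))) summable_on G"
    and "norm ((\<Sum>\<^sub>\<infinity>E\<in>G. measure M E *\<^sub>R f (t E)) - x) \<le> e"
proof -
  interpret finite_measure M by fact
  have pG: "partition_on A G" and pP: "partition_on A P"
    and cG: "countable G" and mG: "G \<subseteq> sets M" and mP: "P \<subseteq> sets M"
    using P G unfolding measurable_partition_def by auto
  have dG: "disjoint G" "\<Union>G = A" using pG unfolding partition_on_def by auto
  let ?u = "\<lambda>E. measure M E *\<^sub>R f (t E)"
  have fm: "C \<in> fmeasurable M" if "C \<in> sets M" for C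
    using that by (simp add: fmeasurable_eq_sets)
  have hs: "(measure M has_sum measure M (\<Union>H)) H" if "H \<subseteq> G" "\<Union>H \<in> sets M" for H
  proof (rule has_sum_measure_Union)
    show "countable H" using cG that(1) by (rule countable_subset[rotated])
    show "disjoint H" using dG(1) that(1) by (rule pairwise_subset)
    show "H \<subseteq> fmeasurable M" using that(1) mG fm by blast
    show "\<Union>H \<in> fmeasurable M" using that(2) by (rule fm)
  qed
  obtain B where B: "\<And>p. p \<in> A \<Longrightarrow> norm (f p) \<le> B"
    using bdd unfolding bounded_iff by blast
  have tA: "t E \<in> E" "t E \<in> A" if "E \<in> G" for E
    using G(3) that dG(2) unfolding sampling_def by blast+
  \<comment> \<open>Boundedness of \<open>f\<close> yields absolute convergence: the measures of the
    members of \<open>G\<close> sum to the finite measure of \<open>A\<close>.\<close>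
  have "(\<lambda>E. measure M E * B) summable_on G"
    using hs[of G] A dG(2) by (intro summable_on_cmult_left has_sum_imp_summable) simp
  then show abs: "(\<lambda>E. norm (?u E)) summable_on G"
    by (rule Infinite_Sum.abs_summable_on_comparison_test') (simp add: B tA(2) mult_left_mono)
  then have sG: "?u summable_on G" by (rule Infinite_Sum.abs_summable_summable)
  have "norm ((\<Sum>D\<in>P. \<Sum>\<^sub>\<infinity>E\<in>{E\<in>G. E \<subseteq> D}. ?u E) - x) \<le> e"
  proof (rule norm_sum_replace_le[OF \<open>finite P\<close>, where B = "\<lambda>D. D"
          and v = "\<lambda>D p. measure M D *\<^sub>R f p"])
    fix s :: "'w set \<Rightarrow> 'w"
    assume "\<And>D. D \<in> P \<Longrightarrow> s D \<in> D"
    then show "norm ((\<Sum>D\<in>P. measure M D *\<^sub>R f (s D)) - x) \<le> e"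
      by (intro le) (simp add: sampling_def)
  next
    fix D a assume D: "D \<in> P" and a: "\<And>p. p \<in> D \<Longrightarrow> norm (a + measure M D *\<^sub>R f p) \<le> e"
    let ?H = "{E\<in>G. E \<subseteq> D}"
    have U: "\<Union>?H = D" using finer_Union_subsets[OF G(2) D] .
    have "D \<noteq> {}" using pP D unfolding partition_on_def by blast
    show "norm (a + (\<Sum>\<^sub>\<infinity>E\<in>?H. ?u E)) \<le> e"
    \<comment> \<open>The weights are the measures of the members of \<open>G\<close> inside
      \<open>D\<close>, with total the measure of \<open>D\<close>; their sampling points lie in
      \<open>D\<close>, so \<open>a\<close> applies to them.\<close>
    proof (rule norm_add_weighted_infsum_le)
      show "(measure M has_sum measure M D) ?H" using hs[of ?H] U D mP
        by (metis (no_types, lifting) mem_Collect_eq subsetD subsetI)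
      show "?u summable_on ?H" using sG by (rule summable_on_subset_banach) auto
      show "?H \<noteq> {}" using U \<open>D \<noteq> {}\<close> by auto
      show "norm (a + measure M D *\<^sub>R f (t E)) \<le> e" if "E \<in> ?H" for E
        using that tA(1)[of E] by (intro a) auto
    qed simp
  qed
  then show "norm ((\<Sum>\<^sub>\<infinity>E\<in>G. ?u E) - x) \<le> e"
    using infsum_eq_sum_over_coarser[OF pG pP G(2) \<open>finite P\<close> sG] by simp
qed

lemma interval_partition_borel:
  assumes "interval_partition P" "D \<in> P"
  shows "D \<in> sets borel" "D \<subseteq> {0..1}"
proof -
  have "is_interval D" "\<Union>P = {0..1}"
    using assms unfolding interval_partition_def partition_on_def by blast+
  then show "D \<in> sets borel" "D \<subseteq> {0..1}"
    using assms(2) by (blast intro: real_interval_borel_measurable)+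
qed

lemma has_riemann_integral_imp_has_RL_integral:
  fixes f :: "real \<Rightarrow> 'a::banach"
  assumes bdd: "bounded (f ` {0..1})" and f: "has_riemann_integral f x"
  shows "has_RL_integral (lebesgue_on {0..1}) {0..1} f x"
  unfolding has_RL_integral_def
proof (intro allI impI)
  let ?M = "lebesgue_on {0..1::real}"
  fix \<epsilon> :: real assume \<epsilon>: "\<epsilon> > 0"
  \<comment> \<open>Averaging preserves only the non-strict bound, so half of \<epsilon> is used to
    end with a strict one.\<close>
  then have "\<epsilon> / 2 > 0" by simp
  then obtain \<delta> where \<delta>: "\<delta> > 0" "\<And>P t. interval_partition P \<Longrightarrow> (\<forall>D\<in>P. measure lborel D < \<delta>) \<Longrightarrow>
      sampling P t \<Longrightarrow> norm ((\<Sum>D\<in>P. measure lborel D *\<^sub>R f (t D)) - x) < \<epsilon> / 2"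
    using f unfolding has_riemann_integral_def by meson
  obtain P where P: "interval_partition P" "\<forall>D\<in>P. measure lborel D < \<delta>"
    using exists_fine_interval_partition[OF \<delta>(1)] by blast
  \<comment> \<open>Riemann sums use \<open>lborel\<close>, RL-sums use \<open>lebesgue_on\<close>;
    the two measures agree on Borel subsets of the unit interval.\<close>
  have eq: "measure ?M D = measure lborel D" if "D \<in> P" for D
    using interval_partition_borel[OF P(1) that] by (simp add: measure_restrict_space)
  have mP: "measurable_partition ?M {0..1} P" "finite P"
    using P(1) interval_partition_borel[OF P(1)]
    unfolding measurable_partition_def interval_partition_def
    by (auto simp: sets_restrict_space_iff countable_finite)
  have le: "norm ((\<Sum>D\<in>P. measure ?M D *\<^sub>R f (s D)) - x) \<le> \<epsilon> / 2" if "sampling P s" for s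
    using \<delta>(2)[OF P that] by (simp add: eq)
  have "finite_measure ?M"
    by (rule finite_measure_lebesgue_on) simp
  moreover have "{0..1} \<in> sets ?M" by (simp add: sets_restrict_space_iff)
  ultimately have RL: "(\<lambda>D. norm (measure ?M D *\<^sub>R f (t D))) summable_on G"
    "norm ((\<Sum>\<^sub>\<infinity>D\<in>G. measure ?M D *\<^sub>R f (t D)) - x) \<le> \<epsilon> / 2"
    if "measurable_partition ?M {0..1} G" "finer G P" "sampling G t" for G t
    using RL_sum_of_refinement[OF _ bdd _ mP that le] by blast+
  show "\<exists>P. measurable_partition ?M {0..1} P \<and>
      (\<forall>G t. measurable_partition ?M {0..1} G \<and> finer G P \<and> sampling G t \<longrightarrow>
        (\<lambda>D. norm (measure ?M D *\<^sub>R f (t D))) summable_on G \<and>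
        norm ((\<Sum>\<^sub>\<infinity>D\<in>G. measure ?M D *\<^sub>R f (t D)) - x) < \<epsilon>)"
  proof (intro exI[of _ P] conjI allI impI)
    fix G t assume "measurable_partition ?M {0..1} G \<and> finer G P \<and> sampling G t"
    then have G: "measurable_partition ?M {0..1} G" "finer G P" "sampling G t" by auto
    show "(\<lambda>D. norm (measure ?M D *\<^sub>R f (t D))) summable_on G" by (rule RL(1)[OF G])
    show "norm ((\<Sum>\<^sub>\<infinity>D\<in>G. measure ?M D *\<^sub>R f (t D)) - x) < \<epsilon>"
      using RL(2)[OF G] \<epsilon> by linarith
  qed (rule mP(1))
qed

theorem theorem14:
  fixes f :: "real \<Rightarrow> 'a::banach"
  assumes "bounded (f ` {0..1})"
    and "riemann_integrable f"
  shows "RL_integrable (lebesgue_on {0..1}) {0..1} f \<and>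
    RL_integral (lebesgue_on {0..1}) {0..1} f = riemann_integral f"
proof -
  obtain x where x: "has_riemann_integral f x"
    using assms(2) unfolding riemann_integrable_def by blast
  then have "has_RL_integral (lebesgue_on {0..1}) {0..1} f x"
    using assms(1) by (intro has_riemann_integral_imp_has_RL_integral)
  then show ?thesis
    using RL_integral_eq riemann_integral_eq[OF x] unfolding RL_integrable_def by blast
qed

end
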